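(* Let $V$ be the four dimensional real vector space with ordered basis $(e_1,f_1,e_2,f_2)$. Let $N_1,N_2$ be the nilpotent endomorphisms of $V$ given by $$N_1(e_1)=f_1,\quad N_1(f_1)=0,\quad N_1(e_2)=f_2,\quad N_1(f_2)=0,$$ $$N_2(e_1)=f_2,\quad N_2(f_1)=0,\quad N_2(e_2)=0,\quad N_2(f_2)=0.$$ Let $W$ be the increasing filtration of $V$ with $\mathrm{gr}^W_kV=0$ for $k\ne1$, and let $F$ be the decreasing filtration of $V_{\mathbb C}=V\otimes\mathbb C$ with $\mathrm{gr}_F^kV_{\mathbb C}=0$ for $k\notin[0,1]$ and $F^1=\langle e_1,e_2\rangle$. Let $a$ be a positive real number and set $N_1'=N_1$, $N_2'=aN_1+N_2$. If $Q$ were a skew-symmetric form making $(V,N_1',N_2',W,F)$ into an infinitesimal mixed Hodge module, then one would have $Q(e_2,f_2)>0$, whereas any such $Q$ would satisfy $Q(e_2,f_2)=0$. Consequently $(V,N_1',N_2',W,F)$ does not admit a form $Q$ making it into an infinitesimal mixed Hodge module.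
   Context: Since $W$ is pure of weight $1$, a form making $(V,N_1',N_2',W,F)$ into an infinitesimal mixed Hodge module (IMHM) is a non-degenerate skew-symmetric bilinear form $Q:V\otimes V\to\mathbb R$ such that $N_1',N_2'$ are infinitesimal isometries of $Q$ (i.e. $Q(N_i'u,v)+Q(u,N_i'v)=0$), $N_i'F^p\subset F^{p-1}$, and $\exp(z_1N_1'+z_2N_2')F$ is a nilpotent orbit of pure Hodge structures of weight $1$ polarized by $Q$: whenever $\mathrm{Im}\,z_1,\mathrm{Im}\,z_2\gg0$, the filtration $F(z)=\exp(z_1N_1'+z_2N_2')F$ is a pure Hodge structure of weight $1$ on $V$ with $Q(F^1(z),F^1(z))=0$ and $Q(Cu,\bar u)>0$ for all $0\neq u\in V_{\mathbb C}$, where $C$ is the Weil operator acting as $i^{p-q}$ on $H^{p,q}$. (The remaining IMHM condition, existence for each subset $J\subset\{1,2\}$ of the weight filtration $M(J)$ of $\sum_{j\in J}N_j'$ relative to $W$ with $N_j'M_k(J)\subset M_{k-2}(J)$ for $j\in J$, is automatic in the pure case.) *)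

theory Defs
  imports "HOL-Analysis.Analysis"
begin

text \<open>
  The real vector space is \<open>V = real^'n\<close> and its complexification is \<open>complex^'n\<close>.
  Filtrations are functions on \<open>int\<close>; \<open>gr\<close> in degree \<open>k\<close> vanishes iff two consecutive steps agree.
\<close>

definition cx_vec :: "real^'n \<Rightarrow> complex^'n" where
  "cx_vec v = (\<chi> i. complex_of_real (v $ i))"

definition Re_vec :: "complex^'n \<Rightarrow> real^'n" where
  "Re_vec v = (\<chi> i. Re (v $ i))"

definition Im_vec :: "complex^'n \<Rightarrow> real^'n" where
  "Im_vec v = (\<chi> i. Im (v $ i))"

definition cnj_vec :: "complex^'n \<Rightarrow> complex^'n" where
  "cnj_vec v = (\<chi> i. cnj (v $ i))"

text \<open>Complex-linear extension of an endomorphism and complex-bilinear extension of a form.\<close>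

definition cx_map :: "(real^'n \<Rightarrow> real^'n) \<Rightarrow> complex^'n \<Rightarrow> complex^'n" where
  "cx_map N v = cx_vec (N (Re_vec v)) + \<i> *s cx_vec (N (Im_vec v))"

definition cx_form :: "(real^'n \<Rightarrow> real^'n \<Rightarrow> real) \<Rightarrow> complex^'n \<Rightarrow> complex^'n \<Rightarrow> complex" where
  "cx_form Q u v = Complex (Q (Re_vec u) (Re_vec v) - Q (Im_vec u) (Im_vec v))
                           (Q (Re_vec u) (Im_vec v) + Q (Im_vec u) (Re_vec v))"

definition increasing_filtration :: "(int \<Rightarrow> (real^'n) set) \<Rightarrow> bool" where
  "increasing_filtration W \<longleftrightarrow>
     (\<forall>k. subspace (W k)) \<and> mono W \<and> (\<exists>k. W k = {0}) \<and> (\<exists>k. W k = UNIV)"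

definition decreasing_filtration :: "(int \<Rightarrow> (complex^'n) set) \<Rightarrow> bool" where
  "decreasing_filtration F \<longleftrightarrow>
     (\<forall>p. vec.subspace (F p)) \<and> antimono F \<and> (\<exists>p. F p = UNIV) \<and> (\<exists>p. F p = {0})"

text \<open>Pure Hodge structure of weight \<open>w\<close>: \<open>F p\<close> and the conjugate of \<open>F (w + 1 - p)\<close> are
  complementary for every \<open>p\<close>.\<close>

definition hodge_structure :: "int \<Rightarrow> (int \<Rightarrow> (complex^'n) set) \<Rightarrow> bool" where
  "hodge_structure w F \<longleftrightarrow> decreasing_filtration F \<and>
     (\<forall>p. F p \<inter> cnj_vec ` F (w + 1 - p) = {0} \<and>
          (\<forall>v. \<exists>x \<in> F p. \<exists>y \<in> cnj_vec ` F (w + 1 - p). v = x + y))"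

definition hodge_component :: "(int \<Rightarrow> (complex^'n) set) \<Rightarrow> int \<Rightarrow> int \<Rightarrow> (complex^'n) set" where
  "hodge_component F p q = F p \<inter> cnj_vec ` F q"

text \<open>For a Hodge structure of weight \<open>w\<close> there is exactly one such operator \<open>C\<close>.\<close>

definition weil_operator ::
    "int \<Rightarrow> (int \<Rightarrow> (complex^'n) set) \<Rightarrow> (complex^'n \<Rightarrow> complex^'n) \<Rightarrow> bool" where
  "weil_operator w F C \<longleftrightarrow> Vector_Spaces.linear (*s) (*s) C \<and>
     (\<forall>p q. p + q = w \<longrightarrow> (\<forall>u \<in> hodge_component F p q. C u = (\<i> powi (p - q)) *s u))"

definition polarized_weight1 ::
    "(int \<Rightarrow> (complex^'n) set) \<Rightarrow> (real^'n \<Rightarrow> real^'n \<Rightarrow> real) \<Rightarrow> bool" where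
  "polarized_weight1 F Q \<longleftrightarrow> hodge_structure 1 F \<and>
     (\<forall>u \<in> F 1. \<forall>v \<in> F 1. cx_form Q u v = 0) \<and>
     (\<exists>C. weil_operator 1 F C \<and>
        (\<forall>u. u \<noteq> 0 \<longrightarrow> cx_form Q (C u) (cnj_vec u) \<in> \<real> \<and> 0 < Re (cx_form Q (C u) (cnj_vec u))))"

text \<open>Exponential series of an endomorphism; only used for nilpotent ones, where it terminates.\<close>

definition exp_map :: "(complex^'n \<Rightarrow> complex^'n) \<Rightarrow> complex^'n \<Rightarrow> complex^'n" where
  "exp_map A v = (\<Sum>k. (A ^^ k) v /\<^sub>R fact k)"

definition orbit_filtration ::
    "'i set \<Rightarrow> ('i \<Rightarrow> real^'n \<Rightarrow> real^'n) \<Rightarrow> (int \<Rightarrow> (complex^'n) set) \<Rightarrow> ('i \<Rightarrow> complex)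
      \<Rightarrow> int \<Rightarrow> (complex^'n) set" where
  "orbit_filtration I N F z p = exp_map (\<lambda>v. \<Sum>j\<in>I. z j *s cx_map (N j) v) ` F p"

definition nilpotent_map :: "(real^'n \<Rightarrow> real^'n) \<Rightarrow> bool" where
  "nilpotent_map N \<longleftrightarrow> linear N \<and> (\<exists>m. \<forall>v. (N ^^ m) v = 0)"

text \<open>The degree \<open>j\<close> part of the filtration induced by \<open>M\<close> on the degree \<open>k\<close> graded piece of \<open>W\<close> is
  \<open>(M j \<inter> W k) / gr_denom M W j k\<close>.\<close>

definition gr_denom ::
    "(int \<Rightarrow> (real^'n) set) \<Rightarrow> (int \<Rightarrow> (real^'n) set) \<Rightarrow> int \<Rightarrow> int \<Rightarrow> (real^'n) set" where
  "gr_denom M W j k = {x + y |x y. x \<in> M (j - 1) \<inter> W k \<and> y \<in> M j \<inter> W (k - 1)}"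

text \<open>The last two conjuncts say that \<open>N ^^ l\<close> induces an isomorphism (injective, surjective)
  from the degree \<open>k + l\<close> to the degree \<open>k - l\<close> part of the filtration induced by \<open>M\<close> on the
  degree \<open>k\<close> graded piece of \<open>W\<close>.\<close>

definition relative_weight_filtration ::
    "(real^'n \<Rightarrow> real^'n) \<Rightarrow> (int \<Rightarrow> (real^'n) set) \<Rightarrow> (int \<Rightarrow> (real^'n) set) \<Rightarrow> bool" where
  "relative_weight_filtration N W M \<longleftrightarrow> increasing_filtration M \<and>
     (\<forall>k. N ` M k \<subseteq> M (k - 2)) \<and>
     (\<forall>k. \<forall>l::nat.
        (\<forall>x \<in> M (k + int l) \<inter> W k.
           (N ^^ l) x \<in> gr_denom M W (k - int l) k \<longrightarrow> x \<in> gr_denom M W (k + int l) k) \<and>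
        (\<forall>y \<in> M (k - int l) \<inter> W k. \<exists>x \<in> M (k + int l) \<inter> W k.
           y - (N ^^ l) x \<in> gr_denom M W (k - int l) k))"

text \<open>
  \<open>Q\<close> makes \<open>(V, N, W, F)\<close> into an infinitesimal mixed Hodge module, in the case where \<open>W\<close> is pure
  of weight 1, so that the graded polarization is a single form on \<open>V\<close> itself.
\<close>

definition IMHM_form_weight1 ::
    "'i set \<Rightarrow> ('i \<Rightarrow> real^'n \<Rightarrow> real^'n) \<Rightarrow> (int \<Rightarrow> (real^'n) set) \<Rightarrow> (int \<Rightarrow> (complex^'n) set)
      \<Rightarrow> (real^'n \<Rightarrow> real^'n \<Rightarrow> real) \<Rightarrow> bool" where
  "IMHM_form_weight1 I N W F Q \<longleftrightarrow>
     increasing_filtration W \<and> (\<forall>k. k \<noteq> 1 \<longrightarrow> W k = W (k - 1)) \<and>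
     decreasing_filtration F \<and>
     (\<forall>j\<in>I. nilpotent_map (N j)) \<and> (\<forall>i\<in>I. \<forall>j\<in>I. N i \<circ> N j = N j \<circ> N i) \<and>
     (\<forall>j\<in>I. \<forall>k. N j ` W k \<subseteq> W k) \<and>
     (\<forall>j\<in>I. \<forall>p. cx_map (N j) ` F p \<subseteq> F (p - 1)) \<and>
     bilinear Q \<and> (\<forall>u v. Q u v = - Q v u) \<and> (\<forall>u. (\<forall>v. Q u v = 0) \<longrightarrow> u = 0) \<and>
     (\<forall>j\<in>I. \<forall>u v. Q (N j u) v + Q u (N j v) = 0) \<and>
     (\<exists>b::real. \<forall>z. (\<forall>j\<in>I. b < Im (z j)) \<longrightarrow> polarized_weight1 (orbit_filtration I N F z) Q) \<and>
     (\<forall>J\<subseteq>I. \<exists>M. relative_weight_filtration (\<lambda>v. \<Sum>j\<in>J. N j v) W M \<and>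
        (\<forall>j\<in>J. \<forall>k. N j ` M k \<subseteq> M (k - 2)))"

end

theory Submission
  imports Defs
begin

text \<open>
  The idea is to compare the two conditions that \<open>Q\<close> has to satisfy on the real vector \<open>e\<^sub>2\<close>, which
  lies in \<open>F\<^sup>1\<close>.  On the one hand, infinitesimal isometries form a linear space, so
  \<open>N\<^sub>2 = N\<^sub>2' - a N\<^sub>1'\<close> is one as well; moving it across
  \<open>Q(e\<^sub>2, f\<^sub>2) = Q(e\<^sub>2, N\<^sub>2 e\<^sub>1)\<close> gives \<open>-Q(N\<^sub>2 e\<^sub>2, e\<^sub>1) = 0\<close>.

  On the other hand, move \<open>F\<close> along the purely imaginary direction \<open>z\<^sub>1 = z\<^sub>2 = \<i> y\<close>.
  The vector \<open>e\<^sub>2\<close> then moves to \<open>u = e\<^sub>2 + \<i> s f\<^sub>2\<close> with \<open>s = (1 + a) y\<close>, and the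
  value of the polarization at \<open>u\<close> is \<open>2 s Q(e\<^sub>2, f\<^sub>2)\<close>.  As \<open>s > 0\<close> for large \<open>y\<close>,
  this forces \<open>Q(e\<^sub>2, f\<^sub>2) > 0\<close> (\<open>polarized_weight1_imp_form_pos\<close>).  The two conclusions exclude
  each other, hence there is no \<open>Q\<close>.
\<close>

lemma IMHM_form_weight1D:
  assumes "IMHM_form_weight1 I N W F Q"
  shows "bilinear Q"
    and "\<forall>u v. Q u v = - Q v u"
    and "\<forall>j\<in>I. \<forall>u v. Q (N j u) v + Q u (N j v) = 0"
    and "\<exists>b::real. \<forall>z. (\<forall>j\<in>I. b < Im (z j)) \<longrightarrow>
      polarized_weight1 (orbit_filtration I N F z) Q"
  using assms unfolding IMHM_form_weight1_def by - (elim conjE, assumption)+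

lemma cx_map_scale_cx_vec:
  assumes "linear N"
  shows "cx_map N (c *s cx_vec v) = c *s cx_vec (N v)"
proof -
  have "Re_vec (c *s cx_vec v) = Re c *\<^sub>R v" "Im_vec (c *s cx_vec v) = Im c *\<^sub>R v"
    by (simp_all add: Re_vec_def Im_vec_def cx_vec_def vec_eq_iff)
  then show ?thesis
    using assms
    by (simp only: cx_map_def linear_cmul) (simp add: cx_vec_def vec_eq_iff complex_eq_iff)
qed

lemma exp_map_eq_add:
  assumes "A v = w" "A w = 0" "A 0 = 0"
  shows "exp_map A v = v + w"
proof -
  have zero: "(A ^^ (k + 2)) v = 0" for k
    by (induction k) (simp_all add: assms)
  have "(A ^^ k) v /\<^sub>R fact k = 0" if "k \<notin> {..<2}" for k
    using zero[of "k - 2"] that by (simp del: funpow.simps add_2_eq_Suc')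
  then have "exp_map A v = (\<Sum>k<2. (A ^^ k) v /\<^sub>R fact k)"
    unfolding exp_map_def by (intro suminf_finite) auto
  then show ?thesis
    by (simp add: numeral_2_eq_2 assms)
qed

text \<open>Below the range of its jumps the filtration is constant, and it is exhaustive.\<close>

lemma decreasing_filtration_eq_UNIV:
  assumes "decreasing_filtration F" "\<And>k. k < m \<Longrightarrow> F k = F (k + 1)"
  shows "F m = UNIV"
proof -
  obtain p where p: "F p = UNIV" and anti: "antimono F"
    using assms(1) by (auto simp: decreasing_filtration_def)
  have const: "F (m - int n) = F m" for n
  proof (induction n)
    case (Suc n)
    have "F (m - int (Suc n)) = F (m - int n)"
      using assms(2)[of "m - int (Suc n)"] by (simp add: algebra_simps)
    with Suc show ?case by simp
  qed simp
  show ?thesis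
  proof (cases "p \<le> m")
    case True
    then show ?thesis using const[of "nat (m - p)"] p by simp
  next
    case False
    then have "F p \<subseteq> F m" using anti by (simp add: antimonoD)
    with p show ?thesis by auto
  qed
qed

text \<open>
  That the exponential is onto does not have to be computed: the image filtration is exhaustive, so
  one of its steps is everything, and all of them are images.
\<close>

lemma orbit_filtration_eq_UNIV:
  assumes "decreasing_filtration (orbit_filtration I N F z)" "F p = UNIV"
  shows "orbit_filtration I N F z p = UNIV"
proof -
  obtain q where "orbit_filtration I N F z q = UNIV"
    using assms(1) by (auto simp: decreasing_filtration_def)
  moreover have "orbit_filtration I N F z q \<subseteq> orbit_filtration I N F z p"
    using assms(2) by (auto simp: orbit_filtration_def)
  ultimately show ?thesis by auto
qed

text \<open>
  When \<open>F\<^sup>0\<close> is everything, a vector \<open>u = x + \<i> y\<close> of \<open>F\<^sup>1\<close> has type \<open>(1, 0)\<close>, so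
  \<open>C u = \<i> u\<close>; expanding \<open>Q(\<i> u, cnj u)\<close> in real and imaginary parts leaves
  \<open>2 Q(x, y)\<close>.
\<close>

lemma polarized_weight1_imp_form_pos:
  assumes pol: "polarized_weight1 F Q"
    and bil: "bilinear Q" and skew: "\<And>u v. Q u v = - Q v u"
    and F0: "F 0 = UNIV" and u: "u \<in> F 1" "u \<noteq> 0"
  shows "Q (Re_vec u) (Im_vec u) > 0"
proof -
  obtain C where C: "weil_operator 1 F C"
    and pos: "0 < Re (cx_form Q (C u) (cnj_vec u))"
    using pol u(2) by (auto simp: polarized_weight1_def)
  have "u = cnj_vec (cnj_vec u)"
    by (simp add: cnj_vec_def vec_eq_iff)
  then have "u \<in> hodge_component F 1 0"
    using u(1) unfolding hodge_component_def F0 by blast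
  then have "C u = (\<i> powi (1 - 0)) *s u"
    using C unfolding weil_operator_def by (metis add.right_neutral)
  then have Cu: "C u = \<i> *s u" by simp
  have "Re_vec (\<i> *s u) = - Im_vec u" "Im_vec (\<i> *s u) = Re_vec u"
    "Re_vec (cnj_vec u) = Re_vec u" "Im_vec (cnj_vec u) = - Im_vec u"
    by (simp_all add: Re_vec_def Im_vec_def cnj_vec_def vec_eq_iff)
  then have "Re (cx_form Q (C u) (cnj_vec u)) = - Q (Im_vec u) (Re_vec u) + Q (Re_vec u) (Im_vec u)"
    by (simp add: Cu cx_form_def bilinear_lneg[OF bil] bilinear_rneg[OF bil])
  also have "\<dots> = 2 * Q (Re_vec u) (Im_vec u)"
    using skew[of "Im_vec u" "Re_vec u"] by simp
  finally show ?thesis using pos by simp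
qed

theorem proposition6p41:
  fixes e\<^sub>1 f\<^sub>1 e\<^sub>2 f\<^sub>2 :: "real^4"
    and N\<^sub>1 N\<^sub>2 :: "real^4 \<Rightarrow> real^4" and N' :: "nat \<Rightarrow> real^4 \<Rightarrow> real^4"
    and W :: "int \<Rightarrow> (real^4) set" and F :: "int \<Rightarrow> (complex^4) set" and a :: real
  assumes basis: "e\<^sub>1 = axis 1 1" "f\<^sub>1 = axis 2 1" "e\<^sub>2 = axis 3 1" "f\<^sub>2 = axis 4 1"
    and N1: "linear N\<^sub>1" "N\<^sub>1 e\<^sub>1 = f\<^sub>1" "N\<^sub>1 f\<^sub>1 = 0" "N\<^sub>1 e\<^sub>2 = f\<^sub>2" "N\<^sub>1 f\<^sub>2 = 0"
    and N2: "linear N\<^sub>2" "N\<^sub>2 e\<^sub>1 = f\<^sub>2" "N\<^sub>2 f\<^sub>1 = 0" "N\<^sub>2 e\<^sub>2 = 0" "N\<^sub>2 f\<^sub>2 = 0"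
    and W: "increasing_filtration W" "\<And>k. k \<noteq> 1 \<Longrightarrow> W k = W (k - 1)"
    and F: "decreasing_filtration F" "\<And>k. k \<notin> {0, 1} \<Longrightarrow> F k = F (k + 1)"
      "F 1 = vec.span {cx_vec e\<^sub>1, cx_vec e\<^sub>2}"
    and a: "a > 0"
    and N': "N' 1 = N\<^sub>1" "N' 2 = (\<lambda>v. a *\<^sub>R N\<^sub>1 v + N\<^sub>2 v)"
  shows "(\<forall>Q. IMHM_form_weight1 {1, 2} N' W F Q \<longrightarrow> Q e\<^sub>2 f\<^sub>2 > 0) \<and>
         (\<forall>Q. IMHM_form_weight1 {1, 2} N' W F Q \<longrightarrow> Q e\<^sub>2 f\<^sub>2 = 0) \<and>
         \<not> (\<exists>Q. IMHM_form_weight1 {1, 2} N' W F Q)"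
proof -
  note N'_simps = N' N'(1)[unfolded One_nat_def]
  have pos: "Q e\<^sub>2 f\<^sub>2 > 0" if im: "IMHM_form_weight1 {1, 2} N' W F Q" for Q
  proof -
    have bil: "bilinear Q" and skew: "\<And>u v. Q u v = - Q v u"
      by (fact IMHM_form_weight1D(1)[OF im], rule IMHM_form_weight1D(2)[OF im, rule_format])
    obtain b :: real where b:
      "\<And>z. (\<forall>j\<in>{1, 2}. b < Im (z j)) \<Longrightarrow> polarized_weight1 (orbit_filtration {1, 2} N' F z) Q"
      using IMHM_form_weight1D(4)[OF im] by blast
    \<comment> \<open>Both coordinates lie on the imaginary axis, above \<open>b\<close> and above the origin.\<close>
    define y where "y = \<bar>b\<bar> + 1"
    define s where "s = (1 + a) * y"
    define z :: "nat \<Rightarrow> complex" where "z = (\<lambda>_. \<i> * complex_of_real y)"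
    define A where "A = (\<lambda>v. \<Sum>j\<in>{1, 2}. z j *s cx_map (N' j) v)"
    define u where "u = cx_vec e\<^sub>2 + (\<i> * complex_of_real s) *s cx_vec f\<^sub>2"
    have s: "s > 0" using a by (simp add: s_def y_def)
    have lin: "linear (N' 1)" "linear (N' 2)"
      using N1(1) N2(1) by (auto simp: N'_simps intro: linear_compose_add linear_compose_scale_right)
    have A: "A (c *s cx_vec v) = c *s (z 1 *s cx_vec (N' 1 v) + z 2 *s cx_vec (N' 2 v))" for c v
      using cx_map_scale_cx_vec[OF lin(1)] cx_map_scale_cx_vec[OF lin(2)]
      by (simp add: A_def vector_add_ldistrib vector_smult_assoc mult.commute)
    have "A (cx_vec e\<^sub>2) = (\<i> * complex_of_real s) *s cx_vec f\<^sub>2"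
      using A[of 1 "e\<^sub>2"] N1(4) N2(4)
      by (simp add: N'_simps z_def s_def cx_vec_def vec_eq_iff algebra_simps)
    moreover have "A ((\<i> * complex_of_real s) *s cx_vec f\<^sub>2) = 0"
      using A[of "\<i> * complex_of_real s" "f\<^sub>2"] N1(5) N2(5)
      by (simp add: N'_simps cx_vec_def vec_eq_iff)
    moreover have "A 0 = 0"
      using A[of 0 0] by simp
    ultimately have "exp_map A (cx_vec e\<^sub>2) = u"
      unfolding u_def by (rule exp_map_eq_add)
    moreover have "cx_vec e\<^sub>2 \<in> F 1"
      unfolding F(3) by (intro vec.span_base) simp
    ultimately have u1: "u \<in> orbit_filtration {1, 2} N' F z 1"
      unfolding orbit_filtration_def A_def by blast
    have pol: "polarized_weight1 (orbit_filtration {1, 2} N' F z) Q"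
    proof (rule b)
      have "b < y" unfolding y_def by linarith
      then show "\<forall>j\<in>{1, 2}. b < Im (z j)" by (simp add: z_def)
    qed
    have "F 0 = UNIV"
      using F(1) by (rule decreasing_filtration_eq_UNIV) (rule F(2), simp)
    then have u0: "orbit_filtration {1, 2} N' F z 0 = UNIV"
      using pol by (intro orbit_filtration_eq_UNIV)
        (auto simp: polarized_weight1_def hodge_structure_def)
    have re_u: "Re_vec u = e\<^sub>2" and im_u: "Im_vec u = s *\<^sub>R f\<^sub>2"
      by (simp_all add: u_def Re_vec_def Im_vec_def cx_vec_def vec_eq_iff)
    have "u \<noteq> 0"
    proof
      assume "u = 0"
      then have "e\<^sub>2 = 0" using re_u by (simp add: Re_vec_def vec_eq_iff)
      then show False by (simp add: basis)
    qed
    then have "0 < Q e\<^sub>2 (s *\<^sub>R f\<^sub>2)"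
      using polarized_weight1_imp_form_pos[OF pol bil skew u0 u1] by (simp add: re_u im_u)
    then show ?thesis
      using s by (simp add: bilinear_rmul[OF bil] zero_less_mult_iff)
  qed
  have zero: "Q e\<^sub>2 f\<^sub>2 = 0" if im: "IMHM_form_weight1 {1, 2} N' W F Q" for Q
  proof -
    have bil: "bilinear Q"
      by (fact IMHM_form_weight1D(1)[OF im])
    have iso: "Q (N' j u) v + Q u (N' j v) = 0" if "j \<in> {1, 2}" for j u v
      using IMHM_form_weight1D(3)[OF im] that by blast
    have "Q (N' 2 e\<^sub>2) e\<^sub>1 + Q e\<^sub>2 (N' 2 e\<^sub>1) = 0" "Q (N' 1 e\<^sub>2) e\<^sub>1 + Q e\<^sub>2 (N' 1 e\<^sub>1) = 0"
      by (simp_all add: iso)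
    then have expanded: "a * Q f\<^sub>2 e\<^sub>1 + a * Q e\<^sub>2 f\<^sub>1 + Q e\<^sub>2 f\<^sub>2 = 0"
      and sum: "Q f\<^sub>2 e\<^sub>1 + Q e\<^sub>2 f\<^sub>1 = 0"
      using N1(2,4) N2(2,4)
      by (simp_all add: N'_simps bilinear_radd[OF bil] bilinear_lmul[OF bil] bilinear_rmul[OF bil])
    have "a * (Q f\<^sub>2 e\<^sub>1 + Q e\<^sub>2 f\<^sub>1) + Q e\<^sub>2 f\<^sub>2 = 0"
      using expanded by (simp only: distrib_left)
    then show ?thesis unfolding sum by simp
  qed
  show ?thesis
    using pos zero by (metis less_irrefl)
qed

end
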